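(* For any integers $d\ge s\geq 1$, any $a,\sigma>0$ and any $0<\delta<1$, $$\inf_{\hat S\in\mathcal F(\delta)}\ \sup_{\theta\in\Theta^+(s,a)}\mathbb P_{\theta}\big(\mathrm{supp}(\theta)\not\subseteq \hat S\big)\ \geq\ 1-\frac{1}{(\Delta+1)^s},\qquad \Delta=\Phi\Big(\Phi^{-1}(\delta)-\frac a\sigma\Big).$$ Furthermore, consider the asymptotic setting $s,d\to\infty$, and let $c_s$ denote an arbitrary sequence with $c_s\to\infty$ and $c_s/s\to0$. If $$\frac a\sigma\le\kappa_*:=\Phi^{-1}(\delta)-\Phi^{-1}(c_s/s),$$ then $$\liminf_{d,s\to\infty}\ \inf_{\hat S\in\mathcal F(\delta)}\ \sup_{\theta\in\Theta^+(s,a)}\mathbb P_{\theta}\big(\mathrm{supp}(\theta)\not\subseteq\hat S\big)=1.$$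
   Context: $X=(X_1,\dots,X_d)\sim N(\theta,\sigma^2 I_d)$ with $\theta\in\mathbb R^d$ unknown and $\sigma>0$ known; $\mathbb P_\theta$ is the corresponding probability. $\Phi$ is the standard normal c.d.f., $[d]=\{1,\dots,d\}$, $\mathrm{supp}(\theta)=\{j:\theta_j\ne0\}$, $\|\theta\|_0=|\mathrm{supp}(\theta)|$. The parameter space is $$\Theta^+(s,a)=\{\theta\in\mathbb R^d:\ \|\theta\|_0\le s,\ \min_{j:\theta_j\neq0}\theta_j\ge a\}$$ (the minimum condition is void when $\theta=0$). $\mathcal F(\delta)$ is the class of (measurable) random subsets $S=S(X)\subseteq[d]$ such that for every $j\in[d]$: the event $\{j\in S(X)\}$ depends only on $X_j$, and $\mathbb P_0(j\in S(X))\le1-\delta$, where $\mathbb P_0$ is the probability when $X_j\sim N(0,\sigma^2)$. In asymptotic statements, $s\le d$ both tend to infinity and $a,\sigma$ may depend on $(d,s)$. *)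

theory Defs
  imports "HOL-Probability.Probability"
begin

definition std_normal_cdf :: "real \<Rightarrow> real" where
  "std_normal_cdf = cdf std_normal_distribution"

text \<open>
  The standard normal c.d.f. is a bijection from the reals onto the open unit interval, so
  the following is its inverse for \<open>0 < p < 1\<close> and unspecified for other \<open>p\<close>.
\<close>

definition std_normal_quantile :: "real \<Rightarrow> real" where
  "std_normal_quantile p = inv std_normal_cdf p"

text \<open>
  Since the dimension \<open>d\<close> varies, a vector of dimension \<open>d\<close> is a function that is extensional
  on the index set \<open>{1..d}\<close>.
\<close>

definition euclid :: "nat \<Rightarrow> (nat \<Rightarrow> real) set" where
  "euclid d = {1..d} \<rightarrow>\<^sub>E UNIV"

text \<open>
  The law of \<open>X\<close>, the normal distribution with mean \<open>\<theta>\<close> and covariance \<open>\<sigma>\<^sup>2\<close> times the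
  identity: independent coordinates, the \<open>j\<close>-th one normal with mean \<open>\<theta> j\<close> and standard
  deviation \<open>\<sigma>\<close>.  Its underlying set is \<open>euclid d\<close>.
\<close>

definition gauss :: "nat \<Rightarrow> (nat \<Rightarrow> real) \<Rightarrow> real \<Rightarrow> (nat \<Rightarrow> real) measure" where
  "gauss d \<theta> \<sigma> = (\<Pi>\<^sub>M j\<in>{1..d}. density lborel (normal_density (\<theta> j) \<sigma>))"

definition supp :: "nat \<Rightarrow> (nat \<Rightarrow> real) \<Rightarrow> nat set" where
  "supp d \<theta> = {j \<in> {1..d}. \<theta> j \<noteq> 0}"

definition sparse_params :: "nat \<Rightarrow> nat \<Rightarrow> real \<Rightarrow> (nat \<Rightarrow> real) set" where
  "sparse_params d s a =
     {\<theta> \<in> euclid d. card (supp d \<theta>) \<le> s \<and> (\<forall>j\<in>supp d \<theta>. a \<le> \<theta> j)}"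

text \<open>
  A selector maps the observation \<open>x\<close> to a subset of \<open>{1..d}\<close>.  That the event
  that \<open>j\<close> is selected depends (measurably) only on the \<open>j\<close>-th coordinate is expressed by its membership
  in the sigma-algebra generated by that coordinate.
\<close>

definition selectors :: "nat \<Rightarrow> real \<Rightarrow> real \<Rightarrow> ((nat \<Rightarrow> real) \<Rightarrow> nat set) set" where
  "selectors d \<sigma> \<delta> =
     {S. (\<forall>x\<in>euclid d. S x \<subseteq> {1..d}) \<and>
         (\<forall>j\<in>{1..d}.
            {x \<in> euclid d. j \<in> S x} \<in> sets (vimage_algebra (euclid d) (\<lambda>x. x j) borel) \<and>
            measure (gauss d (\<lambda>_. 0) \<sigma>) {x \<in> euclid d. j \<in> S x} \<le> 1 - \<delta>)}"

definition minimax_risk :: "nat \<Rightarrow> nat \<Rightarrow> real \<Rightarrow> real \<Rightarrow> real \<Rightarrow> ereal" where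
  "minimax_risk d s a \<sigma> \<delta> =
     (INF S\<in>selectors d \<sigma> \<delta>. SUP \<theta>\<in>sparse_params d s a.
        ereal (measure (gauss d \<theta> \<sigma>) {x \<in> euclid d. \<not> supp d \<theta> \<subseteq> S x}))"

text \<open>The joint limit of the pairs \<open>(d, s)\<close> with both components tending to infinity and \<open>s \<le> d\<close>.\<close>

definition ds_at_top :: "(nat \<times> nat) filter" where
  "ds_at_top = inf (at_top \<times>\<^sub>F at_top) (principal {(d, s). s \<le> d})"

end

theory Submission
  imports Defs
begin

text \<open>
  The least favourable parameter is simply \<open>\<theta> = a\<close> on \<open>{1..s}\<close> and \<open>0\<close> elsewhere.  A selector treats
  the coordinates separately, so each coordinate \<open>j \<le> s\<close> is a test of \<open>N(0, \<sigma>\<^sup>2)\<close> against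
  \<open>N(a, \<sigma>\<^sup>2)\<close> of level \<open>1 - \<delta>\<close>, and by Neyman-Pearson it misses \<open>j\<close> with probability at least
  \<open>\<Delta>\<close>.  By independence \<open>S\<close> covers the support with probability at most
  \<open>(1 - \<Delta>)\<^sup>s \<le> 1 / (1 + \<Delta>)\<^sup>s\<close>.  In the asymptotic regime \<open>\<Delta> \<ge> c\<^sub>s / s\<close>, and Bernoulli's inequality
  gives \<open>(1 + \<Delta>)\<^sup>s \<ge> 1 + c\<^sub>s\<close>, which tends to infinity.
\<close>

section \<open>Normal laws on the line: c.d.f., quantile and tails\<close>

abbreviation normal_distribution :: "real \<Rightarrow> real \<Rightarrow> real measure" where
  "normal_distribution \<mu> \<sigma> \<equiv> density lborel (normal_density \<mu> \<sigma>)"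

interpretation std_normal: real_distribution std_normal_distribution
  by (rule real_dist_normal_dist)

text \<open>A c.d.f. is continuous exactly where there is no atom, and a law with a Lebesgue density
  has none.\<close>

lemma isCont_std_normal_cdf: "isCont std_normal_cdf x"
proof -
  have "emeasure std_normal_distribution {x} = 0"
    by (subst emeasure_density) (auto simp: nn_integral_indicator_singleton' intro!: nn_integral_0_iff_AE[THEN iffD2] AE_I[where N="{x}"])
  then show ?thesis
    by (simp add: std_normal_cdf_def std_normal.isCont_cdf measure_def)
qed

lemma std_normal_cdf_nonneg: "0 \<le> std_normal_cdf x"
  by (simp add: std_normal_cdf_def std_normal.cdf_nonneg)

lemma std_normal_cdf_le_1: "std_normal_cdf x \<le> 1"
  by (simp add: std_normal_cdf_def std_normal.cdf_bounded_prob)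

lemma std_normal_cdf_mono: "x \<le> y \<Longrightarrow> std_normal_cdf x \<le> std_normal_cdf y"
  by (simp add: std_normal_cdf_def std_normal.cdf_nondecreasing)

text \<open>\<open>inv\<close> returns some preimage as soon as one exists, so it suffices that
  \<open>p\<close> lies in the range; this follows from the intermediate value theorem and the
  limits 0 and 1 at the two infinities.\<close>

lemma std_normal_cdf_quantile:
  assumes "0 < p" "p < 1"
  shows "std_normal_cdf (std_normal_quantile p) = p"
proof -
  have "\<forall>\<^sub>F x in at_bot. std_normal_cdf x < p"
    using order_tendstoD(2)[OF std_normal.cdf_lim_at_bot assms(1)] by (simp add: std_normal_cdf_def)
  then obtain l where l: "\<And>x. x \<le> l \<Longrightarrow> std_normal_cdf x < p"
    by (auto simp: eventually_at_bot_linorder)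
  have "\<forall>\<^sub>F x in at_top. p < std_normal_cdf x"
    using order_tendstoD(1)[OF std_normal.cdf_lim_at_top_prob assms(2)] by (simp add: std_normal_cdf_def)
  then obtain u where u: "\<And>x. u \<le> x \<Longrightarrow> p < std_normal_cdf x"
    by (auto simp: eventually_at_top_linorder)
  \<comment> \<open>The right end is \<open>max l u\<close> rather than \<open>u\<close> so that the
    interval is nonempty.\<close>
  have "\<exists>x\<ge>l. x \<le> max l u \<and> std_normal_cdf x = p"
    using l[of l] u[of "max l u"]
    by (intro IVT) (auto simp: isCont_std_normal_cdf)
  then have "p \<in> range std_normal_cdf"
    by auto
  then show ?thesis
    by (simp add: std_normal_quantile_def f_inv_into_f)
qed

lemma measure_normal_distribution_greaterThan:
  assumes "0 < \<sigma>"
  shows "measure (normal_distribution \<mu> \<sigma>) {t<..} = 1 - std_normal_cdf ((t - \<mu>) / \<sigma>)"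
proof -
  interpret N: prob_space "normal_distribution \<mu> \<sigma>"
    by (rule prob_space_normal_density) fact
  \<comment> \<open>The identity is viewed as a random variable with this normal law; standardising
    it reduces the tail to the standard normal one.\<close>
  have "distributed (normal_distribution \<mu> \<sigma>) lborel (\<lambda>x. x) (normal_density \<mu> \<sigma>)"
    by (auto simp: distributed_def distr_id2)
  then have "distr (normal_distribution \<mu> \<sigma>) lborel (\<lambda>x. (x - \<mu>) / \<sigma>) = std_normal_distribution"
    using N.normal_standard_normal_convert[OF assms, of "\<lambda>x. x" \<mu>] by (auto simp: distributed_def)
  then have "std_normal_cdf ((t - \<mu>) / \<sigma>)
      = measure (distr (normal_distribution \<mu> \<sigma>) lborel (\<lambda>x. (x - \<mu>) / \<sigma>)) {..(t - \<mu>) / \<sigma>}"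
    by (simp add: std_normal_cdf_def cdf_def)
  also have "\<dots> = measure (normal_distribution \<mu> \<sigma>) {..t}"
    using assms by (subst measure_distr) (auto intro!: arg_cong2[where f=measure] simp: divide_right_mono divide_le_cancel)
  also have "\<dots> = 1 - measure (normal_distribution \<mu> \<sigma>) {t<..}"
    using N.prob_compl[of "{t<..}"] by (simp add: Compl_eq_Diff_UNIV[symmetric])
  finally show ?thesis by simp
qed

lemma measure_normal_distribution_eq_integral:
  assumes "0 < \<sigma>" "A \<in> sets borel"
  shows "measure (normal_distribution \<mu> \<sigma>) A = (LINT x:A|lborel. normal_density \<mu> \<sigma> x)"
proof -
  interpret N: prob_space "normal_distribution \<mu> \<sigma>"
    by (rule prob_space_normal_density) fact
  have "measure (normal_distribution \<mu> \<sigma>) A = (\<integral>x. indicat_real A x \<partial>normal_distribution \<mu> \<sigma>)"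
    using assms by simp
  also have "\<dots> = (LINT x:A|lborel. normal_density \<mu> \<sigma> x)"
    using assms unfolding set_lebesgue_integral_def
    by (subst integral_density) (auto simp: mult.commute normal_density_nonneg)
  finally show ?thesis .
qed

section \<open>Optimality of the one-sided test of a normal mean\<close>

text \<open>The difference of the indicators of \<open>A\<close> and \<open>B\<close> is at most 0
  on \<open>B\<close> and at least 0 off \<open>B\<close>, while \<open>g - k * f\<close> has the
  opposite sign. Their product is therefore at most 0 everywhere, and integrating it compares the
  gain in power with \<open>k\<close> times the gain in size.\<close>

lemma Neyman_Pearson:
  fixes f g :: "'a \<Rightarrow> real"
  assumes f: "integrable M f" and g: "integrable M g"
    and A: "A \<in> sets M" and B: "B \<in> sets M" and "0 \<le> k"
    and ge: "\<And>x. x \<in> B \<Longrightarrow> k * f x \<le> g x"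
    and le: "\<And>x. x \<in> space M - B \<Longrightarrow> g x \<le> k * f x"
    and size: "(LINT x:A|M. f x) \<le> (LINT x:B|M. f x)"
  shows "(LINT x:A|M. g x) \<le> (LINT x:B|M. g x)"
proof -
  have int: "set_integrable M C h" if "integrable M h" "C \<in> sets M" for C and h :: "'a \<Rightarrow> real"
    using integrable_mult_indicator[OF that(2,1)] by (simp add: set_integrable_def)
  have "(LINT x:A|M. g x) - (LINT x:B|M. g x)
      = (\<integral>x. indicat_real A x * g x - indicat_real B x * g x \<partial>M)"
    using int[OF g A] int[OF g B] by (simp add: set_lebesgue_integral_def set_integrable_def)
  also have "\<dots> \<le> (\<integral>x. k * (indicat_real A x * f x - indicat_real B x * f x) \<partial>M)"
    using int[OF g A] int[OF g B] int[OF f A] int[OF f B] ge le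
    by (intro integral_mono) (auto simp: set_integrable_def indicator_def)
  also have "\<dots> = k * ((LINT x:A|M. f x) - (LINT x:B|M. f x))"
    using int[OF f A] int[OF f B] by (simp add: set_lebesgue_integral_def set_integrable_def)
  also have "\<dots> \<le> 0"
    using size \<open>0 \<le> k\<close> by (simp add: mult_nonneg_nonpos)
  finally show ?thesis by simp
qed

text \<open>The likelihood ratio is the exponential of an affine function of \<open>x\<close> with
  slope of the sign of \<open>a\<close>. For positive \<open>a\<close> it increases, so likelihood
  ratio tests are half-lines.\<close>

lemma normal_density_shift_ratio:
  assumes "0 < \<sigma>"
  shows "normal_density a \<sigma> x = exp ((a * x - a\<^sup>2 / 2) / \<sigma>\<^sup>2) * normal_density 0 \<sigma> x"
proof -
  have "- (x - a)\<^sup>2 / (2 * \<sigma>\<^sup>2) = (a * x - a\<^sup>2 / 2) / \<sigma>\<^sup>2 + - x\<^sup>2 / (2 * \<sigma>\<^sup>2)"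
    using assms by (simp add: field_simps power2_eq_square)
  then show ?thesis
    by (simp add: normal_density_def exp_add[symmetric])
qed

lemma normal_test_power_le:
  assumes "0 < \<delta>" "\<delta> < 1" "0 < a" "0 < \<sigma>" and A: "A \<in> sets borel"
    and size: "measure (normal_distribution 0 \<sigma>) A \<le> 1 - \<delta>"
  shows "measure (normal_distribution a \<sigma>) A \<le> 1 - std_normal_cdf (std_normal_quantile \<delta> - a / \<sigma>)"
proof -
  \<comment> \<open>\<open>t\<close> is the \<delta>-quantile under mean 0, so the half-line above
    \<open>t\<close> has size exactly \<open>1 - \<delta>\<close>.\<close>
  define t where "t = \<sigma> * std_normal_quantile \<delta>"
  define L where "L x = exp ((a * x - a\<^sup>2 / 2) / \<sigma>\<^sup>2)" for x
  have L_mono: "L x \<le> L y" if "x \<le> y" for x y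
    using that assms by (simp add: L_def divide_right_mono)
  have L_nonneg: "0 \<le> L x" for x
    by (simp add: L_def)
  have "measure (normal_distribution 0 \<sigma>) {t<..} = 1 - \<delta>"
    using assms by (simp add: measure_normal_distribution_greaterThan t_def std_normal_cdf_quantile)
  with size have size': "(LINT x:A|lborel. normal_density 0 \<sigma> x) \<le> (LINT x:{t<..}|lborel. normal_density 0 \<sigma> x)"
    using \<open>0 < \<sigma>\<close> A by (simp flip: measure_normal_distribution_eq_integral)
  \<comment> \<open>The critical value is the likelihood ratio at the threshold, \<open>L t\<close>:
    as \<open>L\<close> is monotone, the ratio is at least \<open>L t\<close> above \<open>t\<close>
    and at most \<open>L t\<close> elsewhere.\<close>
  have "(LINT x:A|lborel. normal_density a \<sigma> x) \<le> (LINT x:{t<..}|lborel. normal_density a \<sigma> x)"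
    using A \<open>0 < \<sigma>\<close>
    by (intro Neyman_Pearson[where k = "L t", OF integrable_normal_density integrable_normal_density _ _ _ _ _ size'])
       (auto simp: normal_density_shift_ratio[of \<sigma> a] L_def[symmetric] L_mono mult_right_mono
         normal_density_nonneg L_nonneg)
  then have "measure (normal_distribution a \<sigma>) A \<le> measure (normal_distribution a \<sigma>) {t<..}"
    using \<open>0 < \<sigma>\<close> A by (simp add: measure_normal_distribution_eq_integral)
  also have "\<dots> = 1 - std_normal_cdf (std_normal_quantile \<delta> - a / \<sigma>)"
    using \<open>0 < \<sigma>\<close> by (simp add: measure_normal_distribution_greaterThan t_def diff_divide_distrib)
  finally show ?thesis .
qed

section \<open>The Gaussian product law and the coordinatewise form of selectors\<close>

lemma space_gauss: "space (gauss d \<theta> \<sigma>) = euclid d"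
  by (simp add: gauss_def space_PiM euclid_def)

lemma product_prob_space_normal:
  "0 < \<sigma> \<Longrightarrow> product_prob_space (\<lambda>j. normal_distribution (\<theta> j) \<sigma>)"
  by (simp add: product_prob_space_def product_prob_space_axioms_def product_sigma_finite_def
      prob_space_normal_density prob_space_imp_sigma_finite)

lemma prob_space_gauss:
  assumes "0 < \<sigma>"
  shows "prob_space (gauss d \<theta> \<sigma>)"
  unfolding gauss_def by (intro prob_space_PiM prob_space_normal_density assms)

text \<open>Independence; the coordinates outside \<open>J\<close> are unconstrained and contribute
  a factor 1. It serves with a singleton \<open>J\<close> for the level of a test and with
  \<open>{1..s}\<close> for covering the support.\<close>

lemma measure_gauss_coordinates:
  assumes "0 < \<sigma>" "J \<subseteq> {1..d}" "\<And>j. j \<in> J \<Longrightarrow> B j \<in> sets borel"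
  shows "measure (gauss d \<theta> \<sigma>) {x \<in> euclid d. \<forall>j\<in>J. x j \<in> B j}
    = (\<Prod>j\<in>J. measure (normal_distribution (\<theta> j) \<sigma>) (B j))"
proof -
  interpret product_prob_space "\<lambda>j. normal_distribution (\<theta> j) \<sigma>" "{1..d}"
    using assms(1) by (rule product_prob_space_normal)
  have "emeasure (gauss d \<theta> \<sigma>) {x \<in> euclid d. \<forall>j\<in>J. x j \<in> B j}
      = (\<Prod>j\<in>J. emeasure (normal_distribution (\<theta> j) \<sigma>) (B j))"
    unfolding gauss_def space_gauss[of d \<theta> \<sigma>, unfolded gauss_def, symmetric]
    using assms finite_subset[OF assms(2)] by (intro emeasure_PiM_Collect) auto
  also have "\<dots> = ennreal (\<Prod>j\<in>J. measure (normal_distribution (\<theta> j) \<sigma>) (B j))"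
    by (simp add: M.emeasure_eq_measure prod_ennreal)
  finally show ?thesis
    by (simp add: measure_def prod_nonneg)
qed

text \<open>Members of the sigma-algebra generated by a coordinate are preimages of Borel sets. A
  selector thus amounts to one univariate test per coordinate, whose level is read off from the
  marginal law.\<close>

lemma selector_coordinate_sets:
  assumes "S \<in> selectors d \<sigma> \<delta>" "0 < \<sigma>"
  obtains B where "\<And>j. j \<in> {1..d} \<Longrightarrow> B j \<in> sets borel"
    and "\<And>j x. j \<in> {1..d} \<Longrightarrow> x \<in> euclid d \<Longrightarrow> j \<in> S x \<longleftrightarrow> x j \<in> B j"
    and "\<And>j. j \<in> {1..d} \<Longrightarrow> measure (normal_distribution 0 \<sigma>) (B j) \<le> 1 - \<delta>"
proof -
  have "\<exists>B. B \<in> sets borel \<and> {x \<in> euclid d. j \<in> S x} = {x \<in> euclid d. x j \<in> B}" if "j \<in> {1..d}" for j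
  proof -
    have "{x \<in> euclid d. j \<in> S x} \<in> {(\<lambda>x. x j) -` B \<inter> euclid d | B. B \<in> sets borel}"
      using assms(1) that by (auto simp: selectors_def sets_vimage_algebra2)
    then show ?thesis by blast
  qed
  then have "\<exists>B. \<forall>j\<in>{1..d}. B j \<in> sets borel \<and> {x \<in> euclid d. j \<in> S x} = {x \<in> euclid d. x j \<in> B j}"
    by (intro bchoice) blast
  then obtain B where B: "\<And>j. j \<in> {1..d} \<Longrightarrow> B j \<in> sets borel"
    "\<And>j. j \<in> {1..d} \<Longrightarrow> {x \<in> euclid d. j \<in> S x} = {x \<in> euclid d. x j \<in> B j}"
    by blast
  have "measure (normal_distribution 0 \<sigma>) (B j) \<le> 1 - \<delta>" if "j \<in> {1..d}" for j
  proof -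
    have "measure (normal_distribution 0 \<sigma>) (B j) = measure (gauss d (\<lambda>_. 0) \<sigma>) {x \<in> euclid d. j \<in> S x}"
      using measure_gauss_coordinates[of \<sigma> "{j}" d B "\<lambda>_. 0"] that B assms(2) by simp
    also have "\<dots> \<le> 1 - \<delta>"
      using assms(1) that by (simp add: selectors_def)
    finally show ?thesis .
  qed
  with B show thesis
    by (intro that[of B]) auto
qed

section \<open>Bounds on the minimax risk for fixed dimension and sparsity\<close>

lemma power_one_minus_le_inverse:
  fixes x :: real
  assumes "0 \<le> x" "x \<le> 1"
  shows "(1 - x) ^ n \<le> 1 / (x + 1) ^ n"
proof -
  have "(1 - x) * (x + 1) = 1 - x\<^sup>2"
    by (simp add: algebra_simps power2_eq_square)
  then have "(1 - x) ^ n * (x + 1) ^ n = (1 - x\<^sup>2) ^ n"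
    by (metis power_mult_distrib)
  also have "\<dots> \<le> 1"
    using assms by (intro power_le_one) (auto simp: power_le_one)
  finally show ?thesis
    using assms by (simp add: pos_le_divide_eq)
qed

lemma minimax_risk_ge:
  assumes "0 < \<delta>" "\<delta> < 1" "s \<le> d" "0 < a" "0 < \<sigma>"
  defines "\<Delta> \<equiv> std_normal_cdf (std_normal_quantile \<delta> - a / \<sigma>)"
  shows "ereal (1 - 1 / (\<Delta> + 1) ^ s) \<le> minimax_risk d s a \<sigma> \<delta>"
  unfolding minimax_risk_def
proof (rule INF_greatest)
  fix S assume S: "S \<in> selectors d \<sigma> \<delta>"
  \<comment> \<open>Restricting the function to \<open>{1..d}\<close> makes it extensional, hence a
    member of \<open>euclid d\<close>.\<close>
  define \<theta> where "\<theta> = (\<lambda>j\<in>{1..d}. if j \<le> s then a else 0)"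
  have supp: "supp d \<theta> = {1..s}"
    using assms by (auto simp: supp_def \<theta>_def)
  have \<theta>: "\<theta> \<in> sparse_params d s a"
    using assms supp by (auto simp: sparse_params_def euclid_def) (auto simp: \<theta>_def)
  obtain B where B: "\<And>j. j \<in> {1..d} \<Longrightarrow> B j \<in> sets borel"
    "\<And>j x. j \<in> {1..d} \<Longrightarrow> x \<in> euclid d \<Longrightarrow> j \<in> S x \<longleftrightarrow> x j \<in> B j"
    "\<And>j. j \<in> {1..d} \<Longrightarrow> measure (normal_distribution 0 \<sigma>) (B j) \<le> 1 - \<delta>"
    by (rule selector_coordinate_sets[OF S \<open>0 < \<sigma>\<close>]) (rule that; blast)
  interpret G: prob_space "gauss d \<theta> \<sigma>"
    by (rule prob_space_gauss) fact
  let ?E = "{x \<in> euclid d. \<forall>j\<in>{1..s}. x j \<in> B j}"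
  have "G.prob ?E = (\<Prod>j\<in>{1..s}. measure (normal_distribution (\<theta> j) \<sigma>) (B j))"
    using assms B by (intro measure_gauss_coordinates) auto
  also have "\<dots> \<le> (\<Prod>j\<in>{1..s}. 1 - \<Delta>)"
  proof (intro prod_mono conjI)
    fix j assume j: "j \<in> {1..s}"
    then show "measure (normal_distribution (\<theta> j) \<sigma>) (B j) \<le> 1 - \<Delta>"
      unfolding \<Delta>_def using assms B(1,3)[of j] normal_test_power_le[of \<delta> a \<sigma> "B j"] by (simp add: \<theta>_def)
  qed simp
  also have "\<dots> \<le> 1 / (\<Delta> + 1) ^ s"
    using power_one_minus_le_inverse[of \<Delta> s] by (simp add: \<Delta>_def std_normal_cdf_nonneg std_normal_cdf_le_1)
  finally have E: "G.prob ?E \<le> 1 / (\<Delta> + 1) ^ s" .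
  \<comment> \<open>Measurability of the covering event is established so that its complement can be
    given probability one minus its own.\<close>
  have "(\<lambda>x. x j) -` B j \<inter> space (gauss d \<theta> \<sigma>) \<in> G.events" if "j \<in> {1..s}" for j
    using that \<open>s \<le> d\<close> B(1)[of j]
    by (intro measurable_sets[where A = borel]) (auto simp: gauss_def intro!: measurable_PiM_component_rev)
  then have "{x \<in> space (gauss d \<theta> \<sigma>). x j \<in> B j} \<in> G.events" if "j \<in> {1..s}" for j
    using that by (simp add: vimage_def Int_def conj_commute)
  then have "{x \<in> space (gauss d \<theta> \<sigma>). \<forall>j\<in>{1..s}. x j \<in> B j} \<in> G.events"
    \<comment> \<open>For \<open>s = 0\<close> the condition is void and the event is the whole
      space; otherwise it is a finite intersection over a nonempty index set.\<close>
    by (cases "s = 0") (simp, intro sets.sets_Collect_finite_All', auto)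
  then have "?E \<in> G.events"
    by (simp only: space_gauss)
  then have "1 - G.prob ?E = G.prob (euclid d - ?E)"
    using G.prob_compl[of ?E] by (simp add: space_gauss)
  also have "euclid d - ?E = {x \<in> euclid d. \<not> supp d \<theta> \<subseteq> S x}"
    unfolding supp using B(2) assms by fastforce
  finally have "1 - 1 / (\<Delta> + 1) ^ s \<le> G.prob {x \<in> euclid d. \<not> supp d \<theta> \<subseteq> S x}"
    using E by linarith
  then show "ereal (1 - 1 / (\<Delta> + 1) ^ s) \<le> (SUP \<theta>\<in>sparse_params d s a.
      ereal (measure (gauss d \<theta> \<sigma>) {x \<in> euclid d. \<not> supp d \<theta> \<subseteq> S x}))"
    by (intro SUP_upper2[OF \<theta>]) simp
qed

text \<open>An infimum over an empty class would be infinite, so a member is exhibited: the selector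
  that selects nothing, of level 0.\<close>

lemma minimax_risk_le_1:
  assumes "\<delta> \<le> 1" "0 < \<sigma>"
  shows "minimax_risk d s a \<sigma> \<delta> \<le> 1"
  unfolding minimax_risk_def
proof (rule INF_lower2)
  show "(\<lambda>_. {}) \<in> selectors d \<sigma> \<delta>"
    using assms by (simp add: selectors_def)
  show "(SUP \<theta>\<in>sparse_params d s a.
      ereal (measure (gauss d \<theta> \<sigma>) {x \<in> euclid d. \<not> supp d \<theta> \<subseteq> {}})) \<le> 1"
    using prob_space.prob_le_1[OF prob_space_gauss[OF assms(2)]] by (intro SUP_least) simp
qed

section \<open>The joint limit in dimension and sparsity\<close>

text \<open>As \<open>s \<le> d\<close>, a threshold on \<open>s\<close> forces the same threshold
  on \<open>d\<close>, so one bound on \<open>s\<close> describes the filter.\<close>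

lemma eventually_ds_at_top:
  "(\<forall>\<^sub>F (d, s) in ds_at_top. P d s) \<longleftrightarrow> (\<exists>N. \<forall>s\<ge>N. \<forall>d\<ge>s. P d s)"
proof -
  have "(\<forall>\<^sub>F (d, s) in ds_at_top. P d s) \<longleftrightarrow> (\<exists>N. \<forall>d\<ge>N. \<forall>s\<ge>N. s \<le> d \<longrightarrow> P d s)"
    by (simp add: ds_at_top_def eventually_inf_principal eventually_prod_sequentially split_beta') blast
  also have "\<dots> \<longleftrightarrow> (\<exists>N. \<forall>s\<ge>N. \<forall>d\<ge>s. P d s)"
    by (meson order_trans)
  finally show ?thesis .
qed

lemma ds_at_top_neq_bot: "ds_at_top \<noteq> bot"
  using eventually_ds_at_top[of "\<lambda>_ _. False"] by (auto simp: trivial_limit_def split_beta')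

text \<open>The risk is squeezed between \<open>1 - 1 / (1 + c s)\<close> and 1; the lower bound
  depends on \<open>s\<close> alone and is thus uniform in \<open>d\<close>.\<close>

lemma minimax_risk_tendsto_1:
  fixes a \<sigma> :: "nat \<Rightarrow> nat \<Rightarrow> real" and c :: "nat \<Rightarrow> real"
  assumes \<delta>: "0 < \<delta>" "\<delta> < 1"
    and pos: "\<And>d s. 1 \<le> s \<Longrightarrow> s \<le> d \<Longrightarrow> 0 < a d s \<and> 0 < \<sigma> d s"
    and c: "filterlim c at_top sequentially" "(\<lambda>s. c s / real s) \<longlonglongrightarrow> 0"
    and le: "\<forall>\<^sub>F (d, s) in ds_at_top.
      a d s / \<sigma> d s \<le> std_normal_quantile \<delta> - std_normal_quantile (c s / real s)"
  shows "((\<lambda>(d, s). minimax_risk d s (a d s) (\<sigma> d s) \<delta>) \<longlongrightarrow> 1) ds_at_top"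
proof (rule tendsto_sandwich)
  obtain N1 where N1: "\<And>d s. N1 \<le> s \<Longrightarrow> s \<le> d \<Longrightarrow>
      a d s / \<sigma> d s \<le> std_normal_quantile \<delta> - std_normal_quantile (c s / real s)"
    using le by (auto simp: eventually_ds_at_top)
  \<comment> \<open>The quantile inverts the c.d.f. only on the open unit interval; divergence of
    \<open>c\<close> puts \<open>c s / real s\<close> above 0, and the vanishing ratio puts it below
    1.\<close>
  have "\<forall>\<^sub>F s in sequentially. 1 \<le> s \<and> 0 < c s \<and> c s / real s < 1"
    using c by (intro eventually_conj eventually_ge_at_top order_tendstoD(2)[OF c(2)])
      (auto simp: filterlim_at_top_dense)
  then obtain N2 where N2: "\<And>s. N2 \<le> s \<Longrightarrow> 1 \<le> s \<and> 0 < c s \<and> c s / real s < 1"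
    by (auto simp: eventually_sequentially)
  have "ereal (1 - 1 / (1 + c s)) \<le> minimax_risk d s (a d s) (\<sigma> d s) \<delta>"
    if "max N1 N2 \<le> s" "s \<le> d" for d s
  proof -
    define \<Delta> where "\<Delta> = std_normal_cdf (std_normal_quantile \<delta> - a d s / \<sigma> d s)"
    have s: "1 \<le> s" "0 < c s" "c s / real s < 1"
      using N2[of s] that by auto
    have "c s / real s = std_normal_cdf (std_normal_quantile (c s / real s))"
      using s by (simp add: std_normal_cdf_quantile)
    also have "\<dots> \<le> \<Delta>"
      unfolding \<Delta>_def using N1[of s d] that by (intro std_normal_cdf_mono) simp
    finally have "c s \<le> real s * \<Delta>"
      using s by (simp add: field_simps)
    \<comment> \<open>Bernoulli's inequality needs \<open>\<Delta> \<ge> -1\<close>. The chain with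
      the preceding bound goes through the monotone map that adds 1.\<close>
    also have "1 + real s * \<Delta> \<le> (1 + \<Delta>) ^ s"
      by (rule Bernoulli_inequality) (use std_normal_cdf_nonneg in \<open>simp add: \<Delta>_def order_trans[of "-1" 0]\<close>)
    finally have "1 + c s \<le> (\<Delta> + 1) ^ s"
      by (simp add: add.commute)
    then have "1 - 1 / (1 + c s) \<le> 1 - 1 / (\<Delta> + 1) ^ s"
      using s by (simp add: frac_le)
    then have "ereal (1 - 1 / (1 + c s)) \<le> ereal (1 - 1 / (\<Delta> + 1) ^ s)"
      by simp
    also have "\<dots> \<le> minimax_risk d s (a d s) (\<sigma> d s) \<delta>"
      unfolding \<Delta>_def using pos[of s d] s that by (intro minimax_risk_ge \<delta>) auto
    finally show ?thesis .
  qed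
  then have "\<forall>\<^sub>F (d, s) in ds_at_top. ereal (1 - 1 / (1 + c s)) \<le> minimax_risk d s (a d s) (\<sigma> d s) \<delta>"
    unfolding eventually_ds_at_top by blast
  then show "\<forall>\<^sub>F p in ds_at_top. ereal (1 - 1 / (1 + c (snd p)))
      \<le> (case p of (d, s) \<Rightarrow> minimax_risk d s (a d s) (\<sigma> d s) \<delta>)"
    by (simp add: split_beta')
  have "\<forall>\<^sub>F (d, s) in ds_at_top. minimax_risk d s (a d s) (\<sigma> d s) \<delta> \<le> 1"
    \<comment> \<open>The threshold 1 is where positivity of \<sigma> begins to be assumed.\<close>
    unfolding eventually_ds_at_top using \<delta> pos by (auto intro!: exI[of _ 1] minimax_risk_le_1)
  then show "\<forall>\<^sub>F p in ds_at_top. (case p of (d, s) \<Rightarrow> minimax_risk d s (a d s) (\<sigma> d s) \<delta>) \<le> 1"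
    by (simp add: split_beta')
  have "filterlim snd sequentially ds_at_top"
    unfolding ds_at_top_def by (rule filterlim_mono[OF filterlim_snd order_refl inf_le1])
  then have "filterlim (\<lambda>p. 1 + c (snd p)) at_infinity ds_at_top"
    by (intro filterlim_at_top_imp_at_infinity filterlim_tendsto_add_at_top[OF tendsto_const]
        filterlim_compose[OF c(1)])
  then have "((\<lambda>p. 1 - 1 / (1 + c (snd p))) \<longlongrightarrow> 1 - 0) ds_at_top"
    by (intro tendsto_diff tendsto_const tendsto_divide_0[OF tendsto_const])
  then show "((\<lambda>p. ereal (1 - 1 / (1 + c (snd p)))) \<longlongrightarrow> 1) ds_at_top"
    unfolding one_ereal_def by simp
qed simp

theorem theorem2p1:
  fixes \<delta> :: real
  assumes "0 < \<delta>" and "\<delta> < 1"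
  shows
    "(\<forall>(d::nat) (s::nat) (a::real) (\<sigma>::real).
        1 \<le> s \<longrightarrow> s \<le> d \<longrightarrow> 0 < a \<longrightarrow> 0 < \<sigma> \<longrightarrow>
        (let \<Delta> = std_normal_cdf (std_normal_quantile \<delta> - a / \<sigma>)
         in ereal (1 - 1 / (\<Delta> + 1) ^ s) \<le> minimax_risk d s a \<sigma> \<delta>)) \<and>
     (\<forall>(a :: nat \<Rightarrow> nat \<Rightarrow> real) (\<sigma> :: nat \<Rightarrow> nat \<Rightarrow> real) (c :: nat \<Rightarrow> real).
        (\<forall>d s. 1 \<le> s \<longrightarrow> s \<le> d \<longrightarrow> 0 < a d s \<and> 0 < \<sigma> d s) \<longrightarrow>
        filterlim c at_top sequentially \<longrightarrow>
        (\<lambda>s. c s / real s) \<longlonglongrightarrow> 0 \<longrightarrow>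
        (\<forall>\<^sub>F (d, s) in ds_at_top.
           a d s / \<sigma> d s \<le> std_normal_quantile \<delta> - std_normal_quantile (c s / real s)) \<longrightarrow>
        Liminf ds_at_top (\<lambda>(d, s). minimax_risk d s (a d s) (\<sigma> d s) \<delta>) = 1)"
proof -
  have "Liminf ds_at_top (\<lambda>(d, s). minimax_risk d s (a d s) (\<sigma> d s) \<delta>) = 1"
    if "\<forall>d s. 1 \<le> s \<longrightarrow> s \<le> d \<longrightarrow> 0 < a d s \<and> 0 < \<sigma> d s"
      "filterlim c at_top sequentially" "(\<lambda>s. c s / real s) \<longlonglongrightarrow> 0"
      "\<forall>\<^sub>F (d, s) in ds_at_top.
         a d s / \<sigma> d s \<le> std_normal_quantile \<delta> - std_normal_quantile (c s / real s)"
    for a \<sigma> :: "nat \<Rightarrow> nat \<Rightarrow> real" and c :: "nat \<Rightarrow> real"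
    \<comment> \<open>A limit along a nontrivial filter is also the limit inferior.\<close>
    using that assms by (intro lim_imp_Liminf ds_at_top_neq_bot minimax_risk_tendsto_1[of _ _ _ c]) auto
  then show ?thesis
    using minimax_risk_ge[OF assms] by (simp add: Let_def)
qed

end
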